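(* Let $p$ be a prime and $q>p$ an integer not divisible by $p$. Let $m=\lfloor q/p\rfloor$ and let $\bar q\in\{1,\ldots,p-1\}$ be the residue of $q$ modulo $p$. For $g\in\mathbb{Z}_p$ with $g\neq 0,1$ let $b_g\in\{0,1,\ldots,p-1\}$ be defined by $b_g\equiv(g-1)^{-1}\bar q\pmod p$. For $g\in\mathbb{Z}_p$, $g\ne 1$, and $j=0,1,\ldots,q$ let $N_g(j)$ be the number of $(\tau_1,\tau_2)\in\mathbb{Z}_p\oplus\mathbb{Z}_q$ with $H_{g1}(\tau_1,\tau_2)=j$. Then: (1) $N_0(m)=(p-\bar q)q$ and $N_0(m+1)=\bar q q$. (2) If $g\neq 0,1$ and $0<b_g<p-\bar q$, then with $\eta:=m\,b_g(p-b_g-\bar q)$, $$N_g(m-1)=\eta,\qquad N_g(m)=q(p-\bar q)-2\eta,\qquad N_g(m+1)=q\bar q+\eta.$$ (3) If $g\neq 0,1$ and $p-\bar q<b_g<p$, then with $\theta:=(m+1)(p-b_g)(\bar q+b_g-p)$, $$N_g(m)=q(p-\bar q)+\theta,\qquad N_g(m+1)=q\bar q-2\theta,\qquad N_g(m+2)=\theta.$$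
   Context: For $g\in\mathbb{Z}_p$ let $\mathcal{I}_g=\{(gt \bmod p,\ t)\in \mathbb{Z}_p\oplus\mathbb{Z}_q: 0\le t<q\}$. For $g,h\in\mathbb{Z}_p$ and $(\tau_1,\tau_2)\in\mathbb{Z}_p\oplus\mathbb{Z}_q$ the (two-dimensional) Hamming correlation is $H_{gh}(\tau_1,\tau_2)=|\mathcal{I}_g\cap(\mathcal{I}_h+(\tau_1,\tau_2))|$, with translation performed in $\mathbb{Z}_p\oplus\mathbb{Z}_q$. (It equals the cyclic Hamming correlation $\sum_{t\in\mathbb{Z}_{pq}}s_g(t)s_h(t-\tau)$ of the CRT sequences $s_g(t)=\mathbf 1[(t\bmod p,t\bmod q)\in\mathcal I_g]$ when $\tau_1\equiv\tau \bmod p$ and $\tau_2\equiv\tau\bmod q$.) *)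

theory Defs
  imports "HOL-Number_Theory.Number_Theory"
begin

text \<open>
  Elements of \<open>\<int>\<^sub>p\<close> are represented by their residues in \<open>{0..<p}\<close>, so that
  \<open>\<int>\<^sub>p \<oplus> \<int>\<^sub>q\<close> becomes a set of pairs of integers with componentwise modular arithmetic.
\<close>

definition residue_pairs :: "int \<Rightarrow> int \<Rightarrow> (int \<times> int) set" where
  "residue_pairs p q = {0..<p} \<times> {0..<q}"

definition char_set :: "int \<Rightarrow> int \<Rightarrow> int \<Rightarrow> (int \<times> int) set" where
  "char_set p q g = {(g * t mod p, t) | t. 0 \<le> t \<and> t < q}"

definition translate :: "int \<Rightarrow> int \<Rightarrow> int \<times> int \<Rightarrow> (int \<times> int) set \<Rightarrow> (int \<times> int) set" where
  "translate p q \<tau> A = (\<lambda>(x, y). ((x + fst \<tau>) mod p, (y + snd \<tau>) mod q)) ` A"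

definition hamming_corr :: "int \<Rightarrow> int \<Rightarrow> int \<Rightarrow> int \<Rightarrow> int \<times> int \<Rightarrow> nat" where
  "hamming_corr p q g h \<tau> = card (char_set p q g \<inter> translate p q \<tau> (char_set p q h))"

text \<open>
  The counts \<open>N\<^sub>g(j)\<close>, always relative to the second index 1. The argument \<open>j\<close> and the
  value are integers, so that the formulas involving them are free of truncated subtraction.
\<close>

definition corr_count :: "int \<Rightarrow> int \<Rightarrow> int \<Rightarrow> int \<Rightarrow> int" where
  "corr_count p q g j =
     int (card {\<tau> \<in> residue_pairs p q. int (hamming_corr p q g 1 \<tau>) = j})"

definition b_val :: "int \<Rightarrow> int \<Rightarrow> int \<Rightarrow> int" where
  "b_val p q g = modular_inverse p (g - 1) * (q mod p) mod p"

end

theory Submission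
  imports Defs
begin

text \<open>
  Put \<open>v = (g - 1)\<^sup>-\<^sup>1\<close>, \<open>b = v q mod p\<close> and \<open>c = v (\<tau>\<^sub>1 - \<tau>\<^sub>2) mod p\<close>. A point \<open>(g t, t)\<close> lies in
  the translate of \<open>I\<^sub>1\<close> iff \<open>t\<close> is congruent to \<open>c\<close> (when \<open>t \<ge> \<tau>\<^sub>2\<close>) or to \<open>c + b\<close> (when \<open>t < \<tau>\<^sub>2\<close>,
  where \<open>t - \<tau>\<^sub>2\<close> wraps around modulo \<open>q\<close>). With \<open>r = \<tau>\<^sub>2 mod p\<close> and \<open>d = (c + b) mod p\<close> this gives
  \<open>H = m + [c < q mod p] - [c < r] + [d < r]\<close>, so \<open>H - m\<close> takes values in \<open>{-1, 0, 1, 2}\<close>. The extreme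
  values are counted directly: \<open>-1\<close> means \<open>q mod p \<le> c < r \<le> c + b < p\<close>, and \<open>2\<close> means
  \<open>c + b - p < r \<le> c < q mod p\<close>. The two middle counts then follow from the total \<open>p q\<close> and from
  the sum of \<open>H - m\<close>, which is \<open>q (q mod p)\<close> because \<open>[c < r]\<close> and \<open>[d < r]\<close> cancel on
  summation over \<open>c\<close>. The case \<open>g = 0\<close> is \<open>b = p - q mod p\<close>, where both extreme counts vanish.
\<close>

section \<open>Counting residue classes in an initial segment\<close>

text \<open>Each full block of length \<open>p\<close> meets the class of \<open>c\<close> once; the
  incomplete last block, of length \<open>T mod p\<close>, meets it once more exactly when
  \<open>c < T mod p\<close>.\<close>

lemma card_residue_class_below:
  fixes p c T :: int
  assumes "0 \<le> c" "c < p" "0 \<le> T"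
  shows "int (card {t \<in> {0..<T}. t mod p = c}) = T div p + of_bool (c < T mod p)"
proof -
  have p: "p > 0" using assms by simp
  have lt: "k * p + c < T \<longleftrightarrow> k < T div p + of_bool (c < T mod p)" for k
  proof -
    have T: "T = T div p * p + T mod p" by simp
    have r: "0 \<le> T mod p" "T mod p < p" using p by auto
    consider "k < T div p" | "k = T div p" | "k > T div p" by linarith
    then show ?thesis
    proof cases
      case 1
      then have "k * p + p \<le> T div p * p"
        using mult_right_mono[of "k + 1" "T div p" p] p by (simp add: distrib_right)
      then have "k * p + c < T" using T r assms by linarith
      then show ?thesis using 1 by simp
    next
      case 2
      then show ?thesis using T by (simp only: ) (smt (verit) of_bool_def)
    next
      case 3
      then have "T div p * p + p \<le> k * p"
        using mult_right_mono[of "T div p + 1" k p] p by (simp add: distrib_right)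
      then have "\<not> k * p + c < T" using T r assms by linarith
      then show ?thesis using 3 by simp
    qed
  qed
  have "{t \<in> {0..<T}. t mod p = c} = (\<lambda>k. k * p + c) ` {0..<T div p + of_bool (c < T mod p)}"
    (is "?A = ?f ` ?B")
  proof (intro equalityI subsetI)
    fix t assume t: "t \<in> ?A"
    then have eq: "t = ?f (t div p)" by (metis (mono_tags) div_mult_mod_eq mem_Collect_eq)
    moreover have "t div p \<in> ?B"
      using lt[of "t div p"] eq t p by (auto simp: pos_imp_zdiv_nonneg_iff)
    ultimately show "t \<in> ?f ` ?B" by blast
  next
    fix t assume "t \<in> ?f ` ?B"
    then obtain k where k: "0 \<le> k" "k < T div p + of_bool (c < T mod p)" "t = k * p + c"
      by auto
    moreover have "0 \<le> k * p" using k p by simp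
    ultimately show "t \<in> ?A" using lt[of k] assms by simp
  qed
  moreover have "inj_on ?f ?B" using p by (auto simp: inj_on_def)
  moreover have "0 \<le> T div p" using assms p by (simp add: pos_imp_zdiv_nonneg_iff)
  ultimately show ?thesis by (simp add: card_image)
qed

lemma card_residue_in_set_below:
  fixes p q :: int
  assumes "p > 0" "q \<ge> 0" "R \<subseteq> {0..<p}"
  shows "int (card {t \<in> {0..<q}. t mod p \<in> R}) = (\<Sum>r\<in>R. q div p + of_bool (r < q mod p))"
proof -
  have fin: "finite R" using assms(3) finite_subset by blast
  have "{t \<in> {0..<q}. t mod p \<in> R} = (\<Union>r\<in>R. {t \<in> {0..<q}. t mod p = r})" by auto
  moreover have "card \<dots> = (\<Sum>r\<in>R. card {t \<in> {0..<q}. t mod p = r})"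
    by (intro card_UN_disjoint fin ballI) (auto intro: finite_subset[of _ "{0..<q}"])
  ultimately have "int (card {t \<in> {0..<q}. t mod p \<in> R})
      = (\<Sum>r\<in>R. int (card {t \<in> {0..<q}. t mod p = r}))" by simp
  also have "\<dots> = (\<Sum>r\<in>R. q div p + of_bool (r < q mod p))"
    using assms by (intro sum.cong card_residue_class_below) auto
  finally show ?thesis .
qed

section \<open>The correlation in transformed coordinates\<close>

text \<open>The pair is \<open>(c, T)\<close>, not the original shift, and \<open>b\<close> is a
  free parameter, so the distribution can be studied without reference to \<open>g\<close> or its
  inverse.\<close>

definition corr_dev :: "int \<Rightarrow> int \<Rightarrow> int \<Rightarrow> int \<times> int \<Rightarrow> int" where
  "corr_dev p q b = (\<lambda>(c, T). of_bool (c < q mod p) - of_bool (c < T mod p)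
     + of_bool ((c + b) mod p < T mod p))"

lemma hamming_corr_eq:
  fixes p q g v x T :: int
  assumes p: "p > 0" and v: "[v * (g - 1) = 1] (mod p)" and T: "0 \<le> T" "T < q"
  shows "int (hamming_corr p q g 1 (x, T))
    = q div p + corr_dev p q (v * q mod p) (v * (x - T) mod p, T)"
proof -
  define c where "c = v * (x - T) mod p"
  define d where "d = (c + v * q mod p) mod p"
  have c: "0 \<le> c" "c < p" and d: "0 \<le> d" "d < p" using p by (auto simp: c_def d_def)
  have solve: "g * t mod p = (t + y) mod p \<longleftrightarrow> t mod p = v * y mod p" for t y
  proof -
    have "coprime v p"
      using v by (metis cong_imp_coprime coprime_1_left coprime_mult_left_iff cong_sym)
    have "g * t mod p = (t + y) mod p \<longleftrightarrow> [(g - 1) * t = y] (mod p)"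
      by (simp add: cong_def[symmetric] cong_iff_dvd_diff algebra_simps)
    also have "\<dots> \<longleftrightarrow> [v * ((g - 1) * t) = v * y] (mod p)"
      using \<open>coprime v p\<close> by (simp add: cong_mult_lcancel)
    also have "\<dots> \<longleftrightarrow> [t = v * y] (mod p)"
      using cong_scalar_right[OF v, of t]
      by (metis (no_types, lifting) cong_sym cong_trans mult.assoc mult_1)
    finally show ?thesis by (simp add: cong_def)
  qed
  have mem: "(y, t) \<in> translate p q (x, T) (char_set p q 1) \<longleftrightarrow>
      0 \<le> t \<and> t < q \<and> y = ((t - T) mod q + x) mod p" for y t
  proof
    assume "(y, t) \<in> translate p q (x, T) (char_set p q 1)"
    then obtain s where s: "0 \<le> s" "s < q" "y = (s mod p + x) mod p" "t = (s + T) mod q"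
      by (auto simp: translate_def char_set_def)
    then have "(t - T) mod q = s" by (simp add: mod_simps)
    then show "0 \<le> t \<and> t < q \<and> y = ((t - T) mod q + x) mod p"
      using s T by (auto simp: mod_simps)
  next
    assume *: "0 \<le> t \<and> t < q \<and> y = ((t - T) mod q + x) mod p"
    define s where "s = (t - T) mod q"
    have "(s mod p, s) \<in> char_set p q 1" using T by (auto simp: char_set_def s_def)
    moreover have "(y, t) = ((s mod p + x) mod p, (s + T) mod q)"
      using * by (auto simp: s_def mod_simps)
    ultimately show "(y, t) \<in> translate p q (x, T) (char_set p q 1)"
      unfolding translate_def by force
  qed
  define A where "A = {t \<in> {0..<q}. g * t mod p = ((t - T) mod q + x) mod p}"
  have "char_set p q g \<inter> translate p q (x, T) (char_set p q 1) = (\<lambda>t. (g * t mod p, t)) ` A"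
    (is "?L = ?R")
  proof -
    have "(y, t) \<in> ?L \<longleftrightarrow> (y, t) \<in> ?R" for y t
      unfolding Int_iff mem by (auto simp: char_set_def A_def)
    then show ?thesis by (auto simp only: set_eq_iff split_paired_all)
  qed
  moreover have "inj_on (\<lambda>t. (g * t mod p, t)) A" by (auto simp: inj_on_def)
  ultimately have H: "hamming_corr p q g 1 (x, T) = card A"
    by (simp add: hamming_corr_def card_image)
  let ?N = "\<lambda>U e. {t \<in> {0..<U}. t mod p = e}"
  have hi: "g * t mod p = ((t - T) mod q + x) mod p \<longleftrightarrow> t mod p = c" if "T \<le> t" "t < q" for t
    using solve[of t "x - T"] that T by (simp add: c_def algebra_simps)
  have lo: "g * t mod p = ((t - T) mod q + x) mod p \<longleftrightarrow> t mod p = d" if "0 \<le> t" "t < T" for t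
  proof -
    \<comment> \<open>Here \<open>t - T\<close> is negative and wraps once modulo \<open>q\<close>.
      The extra \<open>q\<close> does not vanish modulo \<open>p\<close>: after multiplication by
      \<open>v\<close> it moves the class from \<open>c\<close> to \<open>d\<close>.\<close>
    have "(t - T) mod q = (t - T + q) mod q" by simp
    also have "\<dots> = t - T + q" using that T by (intro mod_pos_pos_trivial) auto
    finally have "g * t mod p = ((t - T) mod q + x) mod p \<longleftrightarrow> g * t mod p = (t + (x - T + q)) mod p"
      by (simp only:) (simp add: algebra_simps)
    also have "\<dots> \<longleftrightarrow> t mod p = d"
      unfolding solve by (simp add: c_def d_def mod_simps distrib_left)
    finally show ?thesis .
  qed
  \<comment> \<open>The stretch from \<open>T\<close> to \<open>q\<close> is written as a difference
    of initial segments, so that \<open>card_residue_class_below\<close> evaluates all three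
    sets.\<close>
  have A: "A = (?N q c - ?N T c) \<union> ?N T d"
  proof -
    have "t \<in> A \<longleftrightarrow> t \<in> (?N q c - ?N T c) \<union> ?N T d" for t
      using hi[of t] lo[of t] T unfolding A_def by (cases "t < T") auto
    then show ?thesis unfolding set_eq_iff by blast
  qed
  have fin: "finite (?N U e)" for U e by (rule finite_subset[of _ "{0..<U}"]) auto
  have "card A = card (?N q c - ?N T c) + card (?N T d)"
    unfolding A using T by (intro card_Un_disjoint finite_Diff fin) auto
  moreover have "card (?N q c - ?N T c) = card (?N q c) - card (?N T c)"
    using T by (intro card_Diff_subset fin) auto
  \<comment> \<open>Keeps the subtraction of cardinalities on \<open>nat\<close> from
    truncating.\<close>
  moreover have "card (?N T c) \<le> card (?N q c)"
    using T by (intro card_mono fin) auto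
  ultimately have "int (card A) = int (card (?N q c)) - int (card (?N T c)) + int (card (?N T d))"
    by linarith
  also have "\<dots> = q div p + corr_dev p q (v * q mod p) (c, T)"
    using card_residue_class_below[of c p q] card_residue_class_below[of c p T]
      card_residue_class_below[of d p T] c d T
    by (simp only: corr_dev_def prod.case d_def[symmetric])
  finally show ?thesis using H by (simp add: c_def)
qed

text \<open>For fixed \<open>T\<close>, the map from \<open>x\<close> to \<open>c\<close> is affine
  with unit slope \<open>v\<close>, hence permutes the residues; its inverse has slope
  \<open>g - 1\<close>.\<close>

lemma corr_count_eq:
  fixes p q g v j :: int
  assumes p: "p > 0" and v: "[v * (g - 1) = 1] (mod p)"
  shows "corr_count p q g (q div p + j)
    = int (card {z \<in> residue_pairs p q. corr_dev p q (v * q mod p) z = j})"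
proof -
  let ?f = "\<lambda>(x, T). (v * (x - T) mod p, T)"
  let ?h = "\<lambda>(c, T). (((g - 1) * c + T) mod p, T)"
  have inv1: "v * (((g - 1) * c + T) mod p - T) mod p = c" if "0 \<le> c" "c < p" for c T
  proof -
    have "v * (((g - 1) * c + T) mod p - T) mod p = v * (((g - 1) * c + T) - T) mod p"
      by (metis mod_diff_left_eq mod_mult_right_eq)
    also have "\<dots> = (v * (g - 1)) * c mod p" by (simp add: algebra_simps)
    also have "\<dots> = c mod p"
      using cong_scalar_right[OF v, of c] by (simp add: cong_def)
    finally show ?thesis using that by simp
  qed
  have inv2: "((g - 1) * (v * (x - T) mod p) + T) mod p = x" if "0 \<le> x" "x < p" for x T
  proof -
    have "((g - 1) * (v * (x - T) mod p) + T) mod p = ((g - 1) * (v * (x - T)) + T) mod p"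
      by (metis mod_add_left_eq mod_mult_right_eq)
    also have "\<dots> = (v * (g - 1) * (x - T) + T) mod p" by (simp add: algebra_simps)
    also have "\<dots> = (x - T + T) mod p"
      using cong_add[OF cong_scalar_right[OF v, of "x - T"] cong_refl[of T]] by (simp add: cong_def)
    finally show ?thesis using that by simp
  qed
  have "bij_betw ?f {\<tau> \<in> residue_pairs p q. int (hamming_corr p q g 1 \<tau>) = q div p + j}
      {z \<in> residue_pairs p q. corr_dev p q (v * q mod p) z = j}"
    by (rule bij_betw_byWitness[where f' = ?h])
      (use p in \<open>auto simp: residue_pairs_def hamming_corr_eq[OF p v] inv1 inv2\<close>)
  then show ?thesis unfolding corr_count_def by (simp add: bij_betw_same_card)
qed

section \<open>Distribution of the deviation for a nonzero residue \<open>b\<close>\<close>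

context
  fixes p q b m qbar :: int
  assumes p: "p > 0" and q: "q > 0" and b: "0 < b" "b < p"
  defines "m \<equiv> q div p" and "qbar \<equiv> q mod p"
begin

lemma add_mod_cases: "0 \<le> c \<Longrightarrow> c < p \<Longrightarrow> (c + b) mod p = (if c + b < p then c + b else c + b - p)"
  using b mod_pos_pos_trivial[of "c + b - p" p] by auto

lemma corr_dev_range: "corr_dev p q b z \<in> {-1, 0, 1, 2}"
  by (cases z) (auto simp: corr_dev_def of_bool_def)

abbreviation dev_count :: "int \<Rightarrow> int" where
  "dev_count j \<equiv> int (card {z \<in> residue_pairs p q. corr_dev p q b z = j})"

text \<open>Reduces linear relations between the counts to pointwise identities of
  indicators.\<close>

lemma dev_count_eq_sum: "dev_count j = (\<Sum>z\<in>residue_pairs p q. of_bool (corr_dev p q b z = j))"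
proof -
  have "finite (residue_pairs p q)" by (simp add: residue_pairs_def)
  then show ?thesis by (simp add: Int_def)
qed

lemma dev_count_total: "dev_count (-1) + dev_count 0 + dev_count 1 + dev_count 2 = p * q"
proof -
  have "dev_count (-1) + dev_count 0 + dev_count 1 + dev_count 2 = (\<Sum>z\<in>residue_pairs p q. 1)"
    unfolding dev_count_eq_sum sum.distrib[symmetric]
    by (intro sum.cong refl) (use corr_dev_range in auto)
  then show ?thesis using p q by (simp add: residue_pairs_def)
qed

lemma sum_of_bool_less: "0 \<le> a \<Longrightarrow> a \<le> p \<Longrightarrow> (\<Sum>c\<in>{0..<p}. of_bool (c < a)) = a"
  for a :: int
proof -
  assume "0 \<le> a" "a \<le> p"
  then have "{0..<p} \<inter> {c. c < a} = {0..<a}" by auto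
  then show ?thesis using \<open>0 \<le> a\<close> by simp
qed

text \<open>The left side is the sum of \<open>corr_dev\<close> over all pairs, grouped by value;
  each \<open>T\<close> contributes \<open>qbar\<close> to that sum.\<close>

lemma dev_count_moment: "- dev_count (-1) + dev_count 1 + 2 * dev_count 2 = q * qbar"
proof -
  have "- dev_count (-1) + dev_count 1 + 2 * dev_count 2
      = (\<Sum>z\<in>residue_pairs p q. corr_dev p q b z)"
    unfolding dev_count_eq_sum sum.distrib[symmetric] sum_negf[symmetric] sum_distrib_left
    by (intro sum.cong refl) (use corr_dev_range in auto)
  also have "\<dots> = (\<Sum>T\<in>{0..<q}. \<Sum>c\<in>{0..<p}. corr_dev p q b (c, T))"
    unfolding residue_pairs_def by (subst sum.swap) (simp add: sum.cartesian_product)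
  also have "\<dots> = (\<Sum>T\<in>{0..<q}. qbar)"
  proof (intro sum.cong refl)
    fix T assume "T \<in> {0..<q}"
    \<comment> \<open>Translation by \<open>b\<close> permutes the residues modulo
      \<open>p\<close>.\<close>
    have shift: "(\<Sum>c\<in>{0..<p}. of_bool ((c + b) mod p < T mod p) :: int)
        = (\<Sum>c\<in>{0..<p}. of_bool (c < T mod p))"
      by (rule sum.reindex_bij_witness[where i = "\<lambda>d. (d - b) mod p" and j = "\<lambda>c. (c + b) mod p"])
        (use p in \<open>auto simp: mod_simps\<close>)
    have "0 \<le> q mod p" "q mod p \<le> p" using p by (auto intro: less_imp_le)
    then show "(\<Sum>c\<in>{0..<p}. corr_dev p q b (c, T)) = qbar"
      unfolding corr_dev_def
      by (simp only: prod.case sum.distrib sum_subtractf shift sum_of_bool_less)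
        (simp add: qbar_def)
  qed
  also have "\<dots> = q * qbar" using q by simp
  finally show ?thesis .
qed

text \<open>Serves both extreme counts: there the admissible \<open>T\<close> over each
  \<open>c\<close> depend only on \<open>T mod p\<close>, and their number is the same for every
  \<open>c\<close>.\<close>

lemma card_Sigma_residues:
  assumes "finite C" "\<And>c. c \<in> C \<Longrightarrow> R c \<subseteq> {0..<p}"
    and "\<And>c. c \<in> C \<Longrightarrow> (\<Sum>r\<in>R c. m + of_bool (r < qbar)) = s"
  shows "int (card (SIGMA c:C. {T \<in> {0..<q}. T mod p \<in> R c})) = int (card C) * s"
proof -
  have "int (card (SIGMA c:C. {T \<in> {0..<q}. T mod p \<in> R c}))
      = (\<Sum>c\<in>C. int (card {T \<in> {0..<q}. T mod p \<in> R c}))"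
    using assms(1) by (subst card_SigmaI) (auto intro: finite_subset[of _ "{0..<q}"])
  also have "\<dots> = (\<Sum>c\<in>C. s)"
  proof (intro sum.cong refl)
    fix c assume "c \<in> C"
    then show "int (card {T \<in> {0..<q}. T mod p \<in> R c}) = s"
      using card_residue_in_set_below[OF p _ assms(2), of q c] assms(3)[of c] q
      by (simp add: m_def qbar_def)
  qed
  finally show ?thesis by simp
qed

text \<open>All terms must be extremal. Since \<open>(c + b) mod p < T mod p \<le> c\<close>, the
  sum \<open>c + b\<close> wraps, leaving \<open>p - b\<close> residues for \<open>T\<close>. They
  are at most \<open>c < qbar\<close>, so each has \<open>m + 1\<close> representatives below
  \<open>q\<close>.\<close>

lemma dev_count_two: "dev_count 2 = (m + 1) * (p - b) * max 0 (qbar + b - p)"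
proof -
  have qb: "0 \<le> qbar" "qbar < p" using p by (auto simp: qbar_def)
  have eq: "{z \<in> residue_pairs p q. corr_dev p q b z = 2}
      = (SIGMA c:{p - b..<qbar}. {T \<in> {0..<q}. T mod p \<in> {c + b - p + 1..c}})" (is "?A = ?B")
  proof -
    have "(c, T) \<in> ?A \<longleftrightarrow> (c, T) \<in> ?B" for c T
    proof (cases "0 \<le> c \<and> c < p")
      case True
      then show ?thesis
        using add_mod_cases[of c] b qb p
        by (auto simp: residue_pairs_def corr_dev_def of_bool_def qbar_def split: if_splits)
    next
      case False
      then show ?thesis using b qb by (auto simp: residue_pairs_def)
    qed
    then show ?thesis by (auto simp only: set_eq_iff split_paired_all)
  qed
  have row: "(\<Sum>r\<in>{c + b - p + 1..c}. m + of_bool (r < qbar)) = (p - b) * (m + 1)"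
    if "c \<in> {p - b..<qbar}" for c
  proof -
    have "(\<Sum>r\<in>{c + b - p + 1..c}. m + of_bool (r < qbar)) = (\<Sum>r\<in>{c + b - p + 1..c}. m + 1)"
      using that by (intro sum.cong refl) auto
    then show ?thesis using b by simp
  qed
  have "dev_count 2 = int (card {p - b..<qbar}) * ((p - b) * (m + 1))"
    unfolding eq by (rule card_Sigma_residues) (use row qb b in auto)
  then show ?thesis by (simp add: max_def algebra_simps)
qed

text \<open>Now \<open>c < T mod p \<le> (c + b) mod p\<close> excludes wrapping and leaves
  \<open>b\<close> residues for \<open>T\<close>. They exceed \<open>c \<ge> qbar\<close>, so each
  has only \<open>m\<close> representatives.\<close>

lemma dev_count_minus_one: "dev_count (-1) = m * b * max 0 (p - b - qbar)"
proof -
  have qb: "0 \<le> qbar" "qbar < p" using p by (auto simp: qbar_def)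
  have eq: "{z \<in> residue_pairs p q. corr_dev p q b z = -1}
      = (SIGMA c:{qbar..<p - b}. {T \<in> {0..<q}. T mod p \<in> {c + 1..c + b}})" (is "?A = ?B")
  proof -
    have "(c, T) \<in> ?A \<longleftrightarrow> (c, T) \<in> ?B" for c T
    proof (cases "0 \<le> c \<and> c < p")
      case True
      have "T mod p < p" using p by simp
      with True show ?thesis
        using add_mod_cases[of c] b qb p
        by (auto simp: residue_pairs_def corr_dev_def of_bool_def qbar_def split: if_splits)
    next
      case False
      then show ?thesis using b qb by (auto simp: residue_pairs_def)
    qed
    then show ?thesis by (auto simp only: set_eq_iff split_paired_all)
  qed
  have row: "(\<Sum>r\<in>{c + 1..c + b}. m + of_bool (r < qbar)) = b * m"
    if "c \<in> {qbar..<p - b}" for c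
  proof -
    have "(\<Sum>r\<in>{c + 1..c + b}. m + of_bool (r < qbar)) = (\<Sum>r\<in>{c + 1..c + b}. m)"
      using that by (intro sum.cong refl) auto
    then show ?thesis using b by simp
  qed
  have "dev_count (-1) = int (card {qbar..<p - b}) * (b * m)"
    unfolding eq by (rule card_Sigma_residues) (use row qb b in auto)
  then show ?thesis by (simp add: max_def algebra_simps)
qed

end

section \<open>Assembling the counts\<close>

text \<open>The arguments of the two maxima are negatives of each other, so at most one of \<eta>
  and \<theta> is nonzero; every case of the theorem is a specialization.\<close>

lemma corr_count_values:
  fixes p q g v b :: int
  assumes p: "p > 0" and q: "q > 0" and v: "[v * (g - 1) = 1] (mod p)"
    and b: "b = v * q mod p" "b \<noteq> 0"
  defines "m \<equiv> q div p" and "qbar \<equiv> q mod p"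
  defines "\<eta> \<equiv> m * b * max 0 (p - b - qbar)"
    and "\<theta> \<equiv> (m + 1) * (p - b) * max 0 (qbar + b - p)"
  shows "corr_count p q g (m - 1) = \<eta>"
    and "corr_count p q g m = q * (p - qbar) - 2 * \<eta> + \<theta>"
    and "corr_count p q g (m + 1) = q * qbar + \<eta> - 2 * \<theta>"
    and "corr_count p q g (m + 2) = \<theta>"
proof -
  have "0 \<le> b" "b < p" using p b by auto
  with b have pb: "0 < b" "b < p" by auto
  note count = corr_count_eq[OF p v, of q, folded b(1) m_def]
  note facts = dev_count_minus_one[OF p q pb, folded m_def qbar_def, folded \<eta>_def]
    dev_count_two[OF p q pb, folded m_def qbar_def, folded \<theta>_def]
    dev_count_total[OF p q pb] dev_count_moment[OF p q pb, folded qbar_def]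
  show "corr_count p q g (m - 1) = \<eta>" "corr_count p q g (m + 2) = \<theta>"
    using count[of "-1"] count[of 2] facts by simp_all
  show "corr_count p q g (m + 1) = q * qbar + \<eta> - 2 * \<theta>"
    using count[of 1] facts by linarith
  have "q * (p - qbar) = p * q - q * qbar" by (simp add: algebra_simps)
  then show "corr_count p q g m = q * (p - qbar) - 2 * \<eta> + \<theta>"
    using count[of 0, unfolded add_0_right] facts by linarith
qed

theorem theorem4:
  fixes p q m qbar :: int
  assumes "prime p" and "q > p" and "\<not> p dvd q"
    and "m = q div p" and "qbar = q mod p"
  shows
    "(corr_count p q 0 m = (p - qbar) * q \<and> corr_count p q 0 (m + 1) = qbar * q) \<and>
     (\<forall>g\<in>{0..<p} - {0, 1}. 0 < b_val p q g \<and> b_val p q g < p - qbar \<longrightarrow>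
        (let \<eta> = m * b_val p q g * (p - b_val p q g - qbar) in
           corr_count p q g (m - 1) = \<eta> \<and>
           corr_count p q g m = q * (p - qbar) - 2 * \<eta> \<and>
           corr_count p q g (m + 1) = q * qbar + \<eta>)) \<and>
     (\<forall>g\<in>{0..<p} - {0, 1}. p - qbar < b_val p q g \<and> b_val p q g < p \<longrightarrow>
        (let \<theta> = (m + 1) * (p - b_val p q g) * (qbar + b_val p q g - p) in
           corr_count p q g m = q * (p - qbar) + \<theta> \<and>
           corr_count p q g (m + 1) = q * qbar - 2 * \<theta> \<and>
           corr_count p q g (m + 2) = \<theta>))"
proof -
  have p: "p > 0" using \<open>prime p\<close> by (simp add: prime_gt_0_int)
  then have q: "q > 0" using \<open>q > p\<close> by simp
  have qb: "0 \<le> qbar" "qbar < p" "qbar \<noteq> 0"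
    using p assms(3,5) by (auto simp: dvd_eq_mod_eq_0)
  \<comment> \<open>For \<open>g = 0\<close> the inverse of \<open>g - 1\<close> is
    \<open>-1\<close>, giving this value of \<open>b\<close>, at which both maxima are 0.\<close>
  have b0: "- q mod p = p - qbar"
    using qb assms(5) by (simp add: zmod_zminus1_eq_if)
  note zero = corr_count_values[OF p q, of "-1" 0, simplified, OF refl, unfolded b0, folded assms(4,5)]
  have "corr_count p q 0 m = (p - qbar) * q" "corr_count p q 0 (m + 1) = qbar * q"
    using zero qb by (simp_all add: mult.commute)
  moreover have inverse: "[modular_inverse p (g - 1) * (g - 1) = 1] (mod p)"
    "b_val p q g = modular_inverse p (g - 1) * q mod p"
    if "g \<in> {0..<p} - {0, 1}" for g
  proof -
    have "\<not> p dvd g - 1" using that zdvd_imp_le[of p "g - 1"] by auto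
    then have "coprime p (g - 1)" using \<open>prime p\<close> by (simp add: prime_imp_coprime)
    then show "[modular_inverse p (g - 1) * (g - 1) = 1] (mod p)"
      by (simp add: cong_modular_inverse2 coprime_commute)
    show "b_val p q g = modular_inverse p (g - 1) * q mod p"
      by (simp add: b_val_def mod_simps)
  qed
  note nonzero = corr_count_values[OF p q inverse, folded assms(4,5)]
  ultimately show ?thesis
    using qb by (auto simp: Let_def nonzero max_def)
qed

end
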